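(* Let $r\in\mathbb{R}$, $\sigma>0$, $T>0$, let $S(t)=e^{(r-\sigma^2/2)t+\sigma B(t)}$ for $t\ge 0$, where $B$ is a standard Brownian motion, and let $A(T)=\frac1T\int_0^T S(t)\,dt$. Then the correlation coefficient $$R:=\frac{\mathbb{E}\left(S(T)A(T)\right)-\mathbb{E}(S(T))\,\mathbb{E}(A(T))}{\sqrt{\operatorname{var}S(T)\,\operatorname{var}A(T)}}$$ is given by $$R=\frac{\exp[rT,\,2rT,\,(2r+\sigma^2)T]}{\sqrt{2\exp[2rT,\,(2r+\sigma^2)T]\;\exp[0,\,rT,\,2rT,\,(2r+\sigma^2)T]}}.$$
   Context: $B:[0,\infty)\to\mathbb{R}$ is standard Brownian motion: $B(0)=0$, increments are independent, and for $0\le s<t$ the increment $B(t)-B(s)$ is normal with mean $0$ and variance $t-s$ (with continuous paths). For a function $f$ and points $a_0,\dots,a_n$, the divided difference $f[a_0,\dots,a_n]$ is the coefficient of $x^n$ in the unique polynomial of degree at most $n$ interpolating $f$ at $a_0,\dots,a_n$; it does not depend on the order of the points. If points coincide and $f$ is sufficiently differentiable, interpolation is understood in the Hermite sense (matching derivatives up to multiplicity minus one). $\exp[a_0,\dots,a_n]$ denotes the divided difference of the exponential function. *)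

theory Defs
  imports "HOL-Probability.Probability" "HOL-Computational_Algebra.Polynomial"
begin

text \<open>Brownian motion is indexed by all reals, but only times \<open>t \<ge> 0\<close> are constrained.
  Every path, not just almost every path, is continuous and starts at 0.\<close>

locale standard_brownian_motion = prob_space M
  for M :: "'a measure" and B :: "real \<Rightarrow> 'a \<Rightarrow> real" +
  assumes start_zero: "\<And>\<omega>. \<omega> \<in> space M \<Longrightarrow> B 0 \<omega> = 0"
    and continuous_paths: "\<And>\<omega>. \<omega> \<in> space M \<Longrightarrow> continuous_on {0..} (\<lambda>t. B t \<omega>)"
    and normal_increments: "\<And>s t. 0 \<le> s \<Longrightarrow> s < t \<Longrightarrow>
      distributed M lborel (\<lambda>\<omega>. B t \<omega> - B s \<omega>) (normal_density 0 (sqrt (t - s)))"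
    and indep_increments: "\<And>(t :: nat \<Rightarrow> real) n. 0 \<le> t 0 \<Longrightarrow> (\<forall>i<n. t i < t (Suc i)) \<Longrightarrow>
      indep_vars (\<lambda>_. borel) (\<lambda>i \<omega>. B (t (Suc i)) \<omega> - B (t i) \<omega>) {..<n}"

definition correlation :: "'a measure \<Rightarrow> ('a \<Rightarrow> real) \<Rightarrow> ('a \<Rightarrow> real) \<Rightarrow> real" where
  "correlation M X Y =
     (prob_space.expectation M (\<lambda>\<omega>. X \<omega> * Y \<omega>)
        - prob_space.expectation M X * prob_space.expectation M Y)
     / sqrt (prob_space.variance M X * prob_space.variance M Y)"

text \<open>Hermite interpolation: a point occurring \<open>m\<close> times in \<open>xs\<close> prescribes the derivatives of
  orders \<open>0, \<dots>, m - 1\<close> there.\<close>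

definition hermite_interpolates :: "real poly \<Rightarrow> (real \<Rightarrow> real) \<Rightarrow> real list \<Rightarrow> bool" where
  "hermite_interpolates p f xs \<longleftrightarrow>
     (\<forall>x \<in> set xs. \<forall>k < count_list xs x. (deriv ^^ k) (poly p) x = (deriv ^^ k) f x)"

text \<open>Meaningful for nonempty \<open>xs\<close> only: the points \<open>a\<^sub>0, \<dots>, a\<^sub>n\<close> form a list of length \<open>n + 1\<close>.\<close>

definition divided_difference :: "(real \<Rightarrow> real) \<Rightarrow> real list \<Rightarrow> real" where
  "divided_difference f xs =
     coeff (THE p. degree p \<le> length xs - 1 \<and> hermite_interpolates p f xs) (length xs - 1)"

end

theory Submission imports Defs begin

text \<open>Both sides are governed by one chain of functions on \<open>[0, T]\<close>. For the exponents
  \<open>2r + \<sigma>\<^sup>2, 2r, r, 0\<close> let \<open>F\<^sub>0 t = exp ((2r + \<sigma>\<^sup>2) t)\<close>, and let every further \<open>F\<^sub>k\<close> vanish at \<open>0\<close> and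
  solve \<open>F\<^sub>k' = l\<^sub>k F\<^sub>k + F\<^sub>k\<^sub>-\<^sub>1\<close>, where \<open>l\<^sub>k\<close> is the \<open>k\<close>-th exponent.

  On the analytic side \<open>F\<^sub>k T = T\<^sup>k exp[l\<^sub>0 T, \<dots>, l\<^sub>k T]\<close> for any exponents, whether or not they coincide
  (\<open>divided_difference_exp_eq_cascade_at\<close>): by Putzer's argument, the solutions of such a chain are the
  coefficients, in the Newton basis, of a polynomial that interpolates \<open>x \<mapsto> exp (t x)\<close> in the sense
  of Hermite. No case distinction on coincident points, such as \<open>r = 0\<close> or \<open>r + \<sigma>\<^sup>2 = 0\<close>, is needed.

  On the probabilistic side, independence of increments and the Gaussian moment generating function
  give \<open>E (S s * S t) = exp (r (s + t) + \<sigma>\<^sup>2 min s t)\<close>. Integrating this over time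
  (\<open>has_bochner_integral_time_integral\<close>, which is Tonelli's theorem) yields the moments of
  \<open>I = T * A\<close> in terms of iterated antiderivatives of exponentials
  (\<open>gbm_time_integral_moments\<close>). Matching these with the chain gives
  \<open>var (S T) = \<sigma>\<^sup>2 F\<^sub>1 T\<close>, \<open>cov (S T, I) = \<sigma>\<^sup>2 F\<^sub>2 T\<close> and \<open>var I = 2 \<sigma>\<^sup>2 F\<^sub>3 T\<close>;
  the powers of \<open>\<sigma>\<^sup>2\<close> and of \<open>T\<close> cancel in the correlation.\<close>

section \<open>Uniqueness of Hermite interpolation\<close>

lemma higher_deriv_poly: "(deriv ^^ k) (poly p) = poly ((pderiv ^^ k) (p :: real poly))"
proof (induction k)
  case (Suc k)
  have "deriv (poly q) = poly (pderiv q)" for q :: "real poly"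
    by (rule ext) (intro DERIV_imp_deriv poly_DERIV)
  with Suc show ?case by simp
qed simp

lemma higher_deriv_exp: "(deriv ^^ k) exp = (exp :: real \<Rightarrow> real)"
proof (induction k)
  case (Suc k)
  have "deriv exp = (exp :: real \<Rightarrow> real)"
    by (rule ext) (intro DERIV_imp_deriv DERIV_exp)
  with Suc show ?case by simp
qed simp

lemma le_order_if_higher_pderivs_vanish:
  fixes p :: "'a :: field_char_0 poly"
  assumes "p \<noteq> 0" "\<And>k. k < m \<Longrightarrow> poly ((pderiv ^^ k) p) x = 0"
  shows "m \<le> order x p"
  using assms
proof (induction m arbitrary: p)
  case (Suc m)
  have root: "poly p x = 0" using Suc.prems(2)[of 0] by simp
  have nz: "pderiv p \<noteq> 0"
  proof
    assume "pderiv p = 0"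
    then obtain c where "p = [:c:]" by (metis pderiv_iszero)
    with root Suc.prems(1) show False by simp
  qed
  have "poly ((pderiv ^^ k) (pderiv p)) x = 0" if "k < m" for k
    using Suc.prems(2)[of "Suc k"] that by (simp add: funpow_swap1)
  from Suc.IH[OF nz this] have "m \<le> order x (pderiv p)" .
  with order_pderiv[OF Suc.prems(1) root] show ?case by simp
qed simp

lemma higher_pderiv_diff:
  fixes p q :: "'a :: idom poly"
  shows "(pderiv ^^ k) (p - q) = (pderiv ^^ k) p - (pderiv ^^ k) q"
  by (induction k) (simp_all add: pderiv_diff)

text \<open>The difference of two interpolants vanishes at each point to the order of its multiplicity in
  the list, so it has at least \<open>length xs\<close> roots, too many for its degree.\<close>
lemma hermite_interpolant_unique:
  assumes "xs \<noteq> []"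
    and "degree p \<le> length xs - 1" "hermite_interpolates p f xs"
    and "degree q \<le> length xs - 1" "hermite_interpolates q f xs"
  shows "p = q"
proof (rule ccontr)
  assume "p \<noteq> q"
  hence nz: "p - q \<noteq> 0" by simp
  have "mset xs \<subseteq># proots (p - q)"
  proof (rule mset_subset_eqI)
    fix x
    have "count_list xs x \<le> order x (p - q)"
    proof (rule le_order_if_higher_pderivs_vanish[OF nz])
      fix k assume k: "k < count_list xs x"
      hence "x \<in> set xs" using count_list_0_iff[of xs x] by force
      with k assms(3,5) show "poly ((pderiv ^^ k) (p - q)) x = 0"
        by (simp add: higher_pderiv_diff hermite_interpolates_def higher_deriv_poly)
    qed
    thus "count (mset xs) x \<le> count (proots (p - q)) x"
      using nz by (simp add: count_mset)
  qed
  hence "length xs \<le> size (proots (p - q))" by (metis size_mset size_mset_mono)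
  also have "\<dots> \<le> degree (p - q)" by (rule size_proots_le)
  also have "\<dots> \<le> length xs - 1" using assms(2,4) by (rule degree_diff_le)
  finally show False using assms(1) by (cases xs) auto
qed

text \<open>Uniqueness turns the definite description in the definition of divided differences into a rule:
  any interpolant of the right degree exhibits the value.\<close>
lemma divided_difference_eqI:
  assumes "xs \<noteq> []" "degree p \<le> length xs - 1" "hermite_interpolates p f xs"
  shows "divided_difference f xs = coeff p (length xs - 1)"
proof -
  have "(THE p. degree p \<le> length xs - 1 \<and> hermite_interpolates p f xs) = p"
    using assms hermite_interpolant_unique[OF assms(1)] by (intro the_equality) auto
  thus ?thesis by (simp add: divided_difference_def)
qed

lemma divided_difference_rev: "divided_difference f (rev xs) = divided_difference f xs"
  by (simp add: divided_difference_def hermite_interpolates_def)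

section \<open>Divided differences of the exponential as a cascade of linear differential equations\<close>

lemma power_dvd_pderiv:
  fixes p :: "'a :: idom poly"
  assumes "q ^ Suc m dvd p"
  shows "q ^ m dvd pderiv p"
proof -
  from assms obtain s where "p = q ^ Suc m * s" by (elim dvdE)
  thus ?thesis
    by (simp add: pderiv_mult pderiv_power_Suc del: power_Suc) (simp add: dvd_add dvd_smult)
qed

lemma higher_pderiv_eq_0_if_power_dvd:
  fixes p :: "'a :: idom poly"
  assumes "[:- x, 1:] ^ m dvd p" "k < m"
  shows "poly ((pderiv ^^ k) p) x = 0"
  using assms
proof (induction k arbitrary: p m)
  case 0
  hence "[:- x, 1:] dvd p" by (metis dvd_power dvd_trans)
  thus ?case by (simp add: poly_eq_0_iff_dvd)
next
  case (Suc k)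
  then obtain m' where "m = Suc m'" by (cases m) auto
  with Suc.prems have "[:- x, 1:] ^ m' dvd pderiv p" "k < m'"
    by (auto intro!: power_dvd_pderiv simp del: power_Suc)
  with Suc.IH show ?case by (simp add: funpow_swap1)
qed

text \<open>The Leibniz rule, which has only two terms because one factor is linear. The truncated \<open>k - 1\<close>
  is harmless at \<open>k = 0\<close>, where its coefficient vanishes.\<close>
lemma higher_pderiv_X_mult:
  fixes p :: "'a :: idom poly"
  shows "(pderiv ^^ k) ([:0, 1:] * p) =
    [:0, 1:] * (pderiv ^^ k) p + smult (of_nat k) ((pderiv ^^ (k - 1)) p)"
proof (induction k)
  case (Suc k)
  have X: "pderiv ([:0, 1:] * u) = [:0, 1:] * pderiv u + u" for u :: "'a poly"
    by (simp add: pderiv_mult pderiv_pCons)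
  have "smult (of_nat k) (pderiv ((pderiv ^^ (k - 1)) p)) = smult (of_nat k) ((pderiv ^^ k) p)"
    by (cases k) simp_all
  hence "(pderiv ^^ Suc k) ([:0, 1:] * p) =
      [:0, 1:] * (pderiv ^^ Suc k) p + ((pderiv ^^ k) p + smult (of_nat k) ((pderiv ^^ k) p))"
    using Suc.IH by (simp add: X pderiv_add pderiv_smult del: mult_pCons_left)
  thus ?case by (simp add: smult_add_left del: mult_pCons_left)
qed simp

definition newton_basis :: "(nat \<Rightarrow> 'a :: comm_ring_1) \<Rightarrow> nat \<Rightarrow> 'a poly" where
  "newton_basis a k = (\<Prod>i<k. [:- a i, 1:])"

lemma newton_basis_simps [simp]:
  "newton_basis a 0 = 1"
  "newton_basis a (Suc k) = [:- a k, 1:] * newton_basis a k"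
  by (simp_all add: newton_basis_def)

lemma newton_basis_monic:
  fixes a :: "nat \<Rightarrow> 'a :: idom"
  shows "degree (newton_basis a k) = k" "coeff (newton_basis a k) k = 1"
proof -
  have "degree (newton_basis a k) = k \<and> coeff (newton_basis a k) k = 1"
  proof (induction k)
    case (Suc k)
    hence "newton_basis a k \<noteq> 0" by auto
    hence "degree (newton_basis a (Suc k)) = Suc k"
      unfolding newton_basis_simps using Suc by (subst degree_mult_eq) auto
    moreover have "lead_coeff (newton_basis a (Suc k)) = 1"
      unfolding newton_basis_simps using Suc by (subst lead_coeff_mult) simp
    ultimately show ?case by simp
  qed simp
  thus "degree (newton_basis a k) = k" "coeff (newton_basis a k) k = 1" by auto
qed

lemma power_count_dvd_newton_basis:
  "[:- x, 1:] ^ count_list (map a [0..<k]) x dvd newton_basis a k"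
proof (induction k)
  case (Suc k)
  thus ?case
    by (cases "a k = x") (auto simp del: mult_pCons_left intro: mult_dvd_mono dvd_mult)
qed simp

text \<open>Multiplication by the variable acts on the Newton basis as
  \<open>x * N\<^sub>k = N\<^sub>k\<^sub>+\<^sub>1 + a\<^sub>k * N\<^sub>k\<close>, so on coefficients it is the right-hand side of the chain of differential
  equations below, up to the one term that leaves the space of polynomials of degree at most \<open>n\<close>.\<close>
lemma newton_shift:
  fixes c :: "nat \<Rightarrow> 'a :: idom"
  shows "(\<Sum>k\<le>n. smult (a k * c k + (if k = 0 then 0 else c (k - 1))) (newton_basis a k)) =
    [:0, 1:] * (\<Sum>k\<le>n. smult (c k) (newton_basis a k)) - smult (c n) (newton_basis a (Suc n))"
proof (induction n)
  case (Suc n)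
  define X where "X = [:0, 1 :: 'a:]"
  have "newton_basis a (Suc (Suc n)) = X * newton_basis a (Suc n) - smult (a (Suc n)) (newton_basis a (Suc n))"
    by (simp add: newton_basis_simps(2)[of a "Suc n"] X_def algebra_simps del: newton_basis_simps)
  with Suc.IH show ?case unfolding X_def[symmetric]
    by (simp add: smult_diff_right smult_add_left distrib_left mult_smult_right
        mult.commute[of "c (Suc n)"] del: newton_basis_simps)
qed simp

lemma linear_ode_zero:
  fixes q :: "real \<Rightarrow> real"
  assumes "\<And>t. t \<in> {0..1} \<Longrightarrow> (q has_real_derivative c * q t) (at t within {0..1})"
    and "q 0 = 0" "t \<in> {0..1}"
  shows "q t = 0"
proof -
  have "((\<lambda>t. exp (- c * t) * q t) has_real_derivative 0) (at s within {0..1})"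
    if "s \<in> {0..1}" for s
    using assms(1)[OF that] by (auto intro!: derivative_eq_intros)
  then obtain d where "\<And>s. s \<in> {0..1} \<Longrightarrow> exp (- c * s) * q s = d"
    using has_field_derivative_zero_constant[of "{0..1::real}" "\<lambda>t. exp (- c * t) * q t"] by auto
  from this[of 0] this[of t] assms(2,3) show ?thesis by simp
qed

text \<open>Let \<open>p\<^sub>t = \<Sum>k\<le>n. f\<^sub>k(t) * N\<^sub>k\<close>. By the differential equations and the shift rule,
  \<open>d/dt p\<^sub>t = x * p\<^sub>t - f\<^sub>n(t) * N\<^sub>n\<^sub>+\<^sub>1\<close>, whereas \<open>d/dt exp (t x) = x * exp (t x)\<close>. The last Newton polynomial
  vanishes at each point to the order of its multiplicity. Hence at a point \<open>y\<close> the \<open>j\<close>-th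
  \<open>x\<close>-derivative \<open>q\<^sub>j\<close> of the error \<open>exp (t x) - p\<^sub>t\<close>, for \<open>j\<close> below the multiplicity, satisfies
  \<open>q\<^sub>j' = y * q\<^sub>j + j * q\<^sub>j\<^sub>-\<^sub>1\<close> with \<open>q\<^sub>j(0) = 0\<close>, and by induction on \<open>j\<close> it is zero. So \<open>p\<^sub>t\<close> is the Hermite
  interpolant, and at \<open>t = 1\<close> its leading coefficient is the divided difference of \<open>exp\<close>.\<close>
lemma divided_difference_exp_eq_cascade:
  fixes a :: "nat \<Rightarrow> real" and f :: "nat \<Rightarrow> real \<Rightarrow> real"
  assumes deriv: "\<And>k t. k \<le> n \<Longrightarrow> t \<in> {0..1} \<Longrightarrow>
      (f k has_real_derivative a k * f k t + (if k = 0 then 0 else f (k - 1) t)) (at t within {0..1})"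
    and init: "\<And>k. k \<le> n \<Longrightarrow> f k 0 = (if k = 0 then 1 else 0)"
  shows "divided_difference exp (map a [0..<Suc n]) = f n 1"
proof -
  define N where "N = newton_basis a"
  define p where "p = (\<lambda>c. \<Sum>k\<le>n. smult (c k) (N k))"
  define xs where "xs = map a [0..<Suc n]"
  define f' where "f' = (\<lambda>t k. a k * f k t + (if k = 0 then 0 else f (k - 1) t))"
  have p_at: "poly ((pderiv ^^ j) (p c)) y = (\<Sum>k\<le>n. c k * poly ((pderiv ^^ j) (N k)) y)" for c j y
    by (simp add: p_def higher_pderiv_sum higher_pderiv_smult poly_sum)
  have shift: "p (f' t) = [:0, 1:] * p (\<lambda>k. f k t) - smult (f n t) (N (Suc n))" for t
    unfolding p_def N_def f'_def by (rule newton_shift)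
  have p_init: "p (\<lambda>k. f k 0) = 1"
  proof -
    have "p (\<lambda>k. f k 0) = (\<Sum>k\<le>n. if k = 0 then N 0 else 0)"
      unfolding p_def by (intro sum.cong) (auto simp: init)
    thus ?thesis by (simp add: N_def)
  qed
  have N_vanish: "poly ((pderiv ^^ j) (N (Suc n))) y = 0" if "j < count_list xs y" for j y
    using higher_pderiv_eq_0_if_power_dvd[OF power_count_dvd_newton_basis that[unfolded xs_def]]
    by (simp add: N_def)
  have key: "\<forall>t\<in>{0..1}. t ^ j * exp (t * y) = poly ((pderiv ^^ j) (p (\<lambda>k. f k t))) y"
    if "j < count_list xs y" for j y
    using that
  proof (induction j rule: less_induct)
    case (less j)
    \<comment> \<open>the \<open>j\<close>-th derivative at \<open>y\<close> of the interpolation error, as a function of time\<close>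
    define q where "q = (\<lambda>t. t ^ j * exp (t * y) - poly ((pderiv ^^ j) (p (\<lambda>k. f k t))) y)"
    have "(q has_real_derivative y * q t) (at t within {0..1})" if t: "t \<in> {0..1}" for t
    proof -
      have "((\<lambda>t. poly ((pderiv ^^ j) (p (\<lambda>k. f k t))) y) has_real_derivative
          poly ((pderiv ^^ j) (p (f' t))) y) (at t within {0..1})"
        unfolding p_at using t deriv by (intro DERIV_sum DERIV_cmult_right) (auto simp: f'_def)
      moreover have "poly ((pderiv ^^ j) (p (f' t))) y =
          y * poly ((pderiv ^^ j) (p (\<lambda>k. f k t))) y + j * (t ^ (j - 1) * exp (t * y))"
      proof -
        have "j * poly ((pderiv ^^ (j - 1)) (p (\<lambda>k. f k t))) y = j * (t ^ (j - 1) * exp (t * y))"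
          using less.IH[of "j - 1"] less.prems t by (cases j) auto
        thus ?thesis using N_vanish[OF less.prems]
          unfolding shift by (simp add: higher_pderiv_diff higher_pderiv_smult higher_pderiv_X_mult
              del: mult_pCons_left)
      qed
      ultimately show ?thesis unfolding q_def
        by (auto intro!: derivative_eq_intros simp: algebra_simps)
    qed
    moreover have "q 0 = 0"
      by (cases j) (simp_all add: q_def p_init funpow_Suc_right del: funpow.simps)
    ultimately have "\<forall>t\<in>{0..1}. q t = 0" using linear_ode_zero by blast
    thus ?case by (simp add: q_def)
  qed
  have "divided_difference exp xs = coeff (p (\<lambda>k. f k 1)) (length xs - 1)"
  proof (rule divided_difference_eqI)
    show "hermite_interpolates (p (\<lambda>k. f k 1)) exp xs"
      using key[rule_format, of _ _ 1]
      by (simp add: hermite_interpolates_def higher_deriv_poly higher_deriv_exp)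
    show "degree (p (\<lambda>k. f k 1)) \<le> length xs - 1"
      unfolding p_def xs_def N_def
      by (intro degree_sum_le) (auto intro!: order_trans[OF degree_smult_le] simp: newton_basis_monic)
  qed (simp add: xs_def)
  also have "\<dots> = (\<Sum>k\<le>n. f k 1 * coeff (N k) n)"
    by (simp add: p_def xs_def coeff_sum)
  also have "\<dots> = (\<Sum>k\<le>n. if k = n then f n 1 else 0)"
    by (intro sum.cong) (auto simp: N_def newton_basis_monic coeff_eq_0)
  finally show ?thesis by (simp add: xs_def)
qed

text \<open>The time change \<open>t = u * T\<close> multiplies all exponents by \<open>T\<close>; dividing \<open>F\<^sub>k\<close> by \<open>T\<^sup>k\<close> restores the
  unit coefficients with which each function drives the next.\<close>
corollary divided_difference_exp_eq_cascade_at: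
  fixes l :: "nat \<Rightarrow> real" and F :: "nat \<Rightarrow> real \<Rightarrow> real"
  assumes T: "T > 0"
    and deriv: "\<And>k t. k \<le> n \<Longrightarrow> t \<in> {0..T} \<Longrightarrow>
      (F k has_real_derivative l k * F k t + (if k = 0 then 0 else F (k - 1) t)) (at t within {0..T})"
    and init: "\<And>k. k \<le> n \<Longrightarrow> F k 0 = (if k = 0 then 1 else 0)"
  shows "divided_difference exp (map (\<lambda>k. l k * T) [0..<Suc n]) = F n T / T ^ n"
proof -
  define f where "f = (\<lambda>k u. F k (u * T) / T ^ k)"
  have "divided_difference exp (map (\<lambda>k. l k * T) [0..<Suc n]) = f n 1"
  proof (rule divided_difference_exp_eq_cascade)
    fix k u assume k: "k \<le> n" and u: "u \<in> {0..1 :: real}"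
    have "(\<lambda>u. u * T) ` {0..1} \<subseteq> {0..T}" "u * T \<in> {0..T}"
      using T u by (auto intro: mult_left_le_one_le)
    hence "(F k has_real_derivative l k * F k (u * T) + (if k = 0 then 0 else F (k - 1) (u * T)))
        (at (u * T) within (\<lambda>u. u * T) ` {0..1})"
      using DERIV_subset[OF deriv[OF k]] by blast
    moreover have "((\<lambda>u. u * T) has_real_derivative T) (at u within {0..1})"
      by (auto intro!: derivative_eq_intros)
    ultimately have "((\<lambda>u. F k (u * T)) has_real_derivative
        (l k * F k (u * T) + (if k = 0 then 0 else F (k - 1) (u * T))) * T) (at u within {0..1})"
      using DERIV_image_chain[of "F k" _ "\<lambda>u. u * T"] by (simp add: o_def)
    hence "(f k has_real_derivative
        (l k * F k (u * T) + (if k = 0 then 0 else F (k - 1) (u * T))) * T / T ^ k) (at u within {0..1})"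
      unfolding f_def by (rule DERIV_cdivide)
    thus "(f k has_real_derivative l k * T * f k u + (if k = 0 then 0 else f (k - 1) u)) (at u within {0..1})"
    proof (rule DERIV_cong)
      show "(l k * F k (u * T) + (if k = 0 then 0 else F (k - 1) (u * T))) * T / T ^ k =
          l k * T * f k u + (if k = 0 then 0 else f (k - 1) u)"
        using T by (cases k) (auto simp: f_def field_simps)
    qed
  qed (simp add: f_def init)
  thus ?thesis by (simp add: f_def)
qed

section \<open>Time integrals of continuous processes\<close>

text \<open>A process with continuous paths is the pointwise limit of its discretisations in time, which
  are jointly measurable because they involve only countably many times.\<close>
lemma borel_measurable_continuous_process:
  fixes X :: "real \<Rightarrow> 'a \<Rightarrow> real"
  assumes meas: "\<And>t. X t \<in> borel_measurable M"
    and cont: "\<And>\<omega>. \<omega> \<in> space M \<Longrightarrow> continuous_on UNIV (\<lambda>t. X t \<omega>)"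
  shows "(\<lambda>(t, \<omega>). X t \<omega>) \<in> borel_measurable (borel \<Otimes>\<^sub>M M)"
proof (rule borel_measurable_LIMSEQ_real)
  define d where "d = (\<lambda>n t. real_of_int \<lfloor>real (Suc n) * t\<rfloor> / real (Suc n))"
  have lim: "(\<lambda>n. d n t) \<longlonglongrightarrow> t" for t
  proof (rule tendsto_sandwich[of "\<lambda>n. t - 1 / real (Suc n)" _ _ "\<lambda>_. t"])
    show "\<forall>\<^sub>F n in sequentially. t - 1 / real (Suc n) \<le> d n t"
    proof (intro always_eventually allI)
      fix n
      have "real (Suc n) * t - 1 \<le> real_of_int \<lfloor>real (Suc n) * t\<rfloor>" by linarith
      hence "(real (Suc n) * t - 1) / real (Suc n) \<le> d n t"
        unfolding d_def by (rule divide_right_mono) simp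
      thus "t - 1 / real (Suc n) \<le> d n t"
        by (simp add: diff_divide_distrib del: of_nat_Suc)
    qed
    show "\<forall>\<^sub>F n in sequentially. d n t \<le> t"
    proof (intro always_eventually allI)
      fix n
      have "real_of_int \<lfloor>real (Suc n) * t\<rfloor> \<le> real (Suc n) * t" by linarith
      thus "d n t \<le> t"
        by (simp add: d_def field_simps del: of_nat_Suc)
    qed
    show "(\<lambda>n. t - 1 / real (Suc n)) \<longlonglongrightarrow> t"
      using tendsto_diff[OF tendsto_const LIMSEQ_inverse_real_of_nat, of t]
      by (simp add: inverse_eq_divide)
  qed simp
  show "(\<lambda>n. case z of (t, \<omega>) \<Rightarrow> X (d n t) \<omega>) \<longlonglongrightarrow> (case z of (t, \<omega>) \<Rightarrow> X t \<omega>)"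
    if "z \<in> space (borel \<Otimes>\<^sub>M M)" for z
  proof -
    obtain t \<omega> where z: "z = (t, \<omega>)" by (cases z)
    with that have "\<omega> \<in> space M" by (auto simp: space_pair_measure)
    from cont[OF this] lim[of t] show ?thesis
      unfolding z by (auto intro!: continuous_on_tendsto_compose[of UNIV "\<lambda>t. X t \<omega>"])
  qed
  show "(\<lambda>(t, \<omega>). X (d n t) \<omega>) \<in> borel_measurable (borel \<Otimes>\<^sub>M M)" for n
  proof -
    have "(\<lambda>z. X (real_of_int \<lfloor>real (Suc n) * fst z\<rfloor> / real (Suc n)) (snd z)) \<in> borel_measurable (borel \<Otimes>\<^sub>M M)"
      by (rule measurable_compose_countable[where f = "\<lambda>i z. X (real_of_int i / real (Suc n)) (snd z)"])
         (use meas in measurable)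
    thus ?thesis by (simp add: d_def case_prod_beta')
  qed
qed

text \<open>Tonelli's theorem for a nonnegative process \<open>X\<close>, with a random weight \<open>Y\<close>. The weight allows
  the lemma to be applied repeatedly: with \<open>Y = X s\<close> it gives the mixed moments of the process
  and its time integral, and then, with \<open>Y\<close> the time integral itself, the second moment of the latter.\<close>
lemma (in sigma_finite_measure) has_bochner_integral_time_integral:
  fixes X :: "real \<Rightarrow> 'a \<Rightarrow> real" and m :: "real \<Rightarrow> real"
  assumes meas: "(\<lambda>(t, \<omega>). X t \<omega>) \<in> borel_measurable (borel \<Otimes>\<^sub>M M)" "Y \<in> borel_measurable M"
    and nonneg: "\<And>t \<omega>. 0 \<le> X t \<omega>" "\<And>\<omega>. 0 \<le> Y \<omega>"
    and mean: "\<And>t. t \<in> {a..b} \<Longrightarrow> has_bochner_integral M (\<lambda>\<omega>. Y \<omega> * X t \<omega>) (m t)"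
    and m: "continuous_on {a..b} m" "(m has_integral J) {a..b}"
  shows "has_bochner_integral M (\<lambda>\<omega>. Y \<omega> * (LBINT t:{a..b}. X t \<omega>)) J"
proof -
  interpret pair_sigma_finite lborel M ..
  define F where "F = (\<lambda>(t, \<omega>). indicator {a..b} t * (Y \<omega> * X t \<omega>))"
  have [measurable]: "(\<lambda>z. X (fst z) (snd z)) \<in> borel_measurable (borel \<Otimes>\<^sub>M M)" "Y \<in> borel_measurable M"
    using meas by (simp_all add: case_prod_beta')
  have F_meas: "F \<in> borel_measurable (lborel \<Otimes>\<^sub>M M)"
    unfolding F_def case_prod_beta' by measurable
  have F_mean: "has_bochner_integral M (\<lambda>\<omega>. F (t, \<omega>)) (indicator {a..b} t * m t)" for t
    by (cases "t \<in> {a..b}") (use mean in \<open>auto simp: F_def has_bochner_integral_zero\<close>)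
  have m_int: "integrable lborel (\<lambda>t. indicator {a..b} t * m t)"
    using borel_integrable_atLeastAtMost'[OF m(1)] by (simp add: set_integrable_def)
  have "(LBINT t:{a..b}. m t) = J"
    using set_borel_integral_eq_integral(2)[OF borel_integrable_atLeastAtMost'[OF m(1)]] m(2)
    by (simp add: integral_unique)
  hence m_J: "(\<integral>t. indicator {a..b} t * m t \<partial>lborel) = J"
    by (simp add: set_lebesgue_integral_def)
  have F_int: "integrable (lborel \<Otimes>\<^sub>M M) F"
  proof (rule Fubini_integrable[OF F_meas])
    have "(\<integral>\<omega>. norm (F (t, \<omega>)) \<partial>M) = indicator {a..b} t * m t" for t
    proof -
      have "norm (F (t, \<omega>)) = F (t, \<omega>)" for \<omega> using nonneg by (simp add: F_def)
      with F_mean[of t] show ?thesis by (simp add: has_bochner_integral_integral_eq)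
    qed
    thus "integrable lborel (\<lambda>t. \<integral>\<omega>. norm (F (t, \<omega>)) \<partial>M)" using m_int by simp
    show "AE t in lborel. integrable M (\<lambda>\<omega>. F (t, \<omega>))"
      using F_mean by (auto simp: has_bochner_integral_iff)
  qed
  have inner: "(\<integral>t. F (t, \<omega>) \<partial>lborel) = Y \<omega> * (LBINT t:{a..b}. X t \<omega>)" for \<omega>
    by (simp add: F_def set_lebesgue_integral_def mult.left_commute[of _ "Y \<omega>"])
  have "(\<integral>\<omega>. (\<integral>t. F (t, \<omega>) \<partial>lborel) \<partial>M) = (\<integral>t. (\<integral>\<omega>. F (t, \<omega>) \<partial>M) \<partial>lborel)"
    using Fubini_integral[of "\<lambda>t \<omega>. F (t, \<omega>)"] F_int by simp
  also have "\<dots> = J"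
    by (simp add: has_bochner_integral_integral_eq[OF F_mean] m_J)
  finally show ?thesis
    using integrable_snd[of "\<lambda>t \<omega>. F (t, \<omega>)"] F_int by (simp add: inner has_bochner_integral_iff)
qed

section \<open>Exponential moments of Brownian motion\<close>

text \<open>Completing the square: multiplying a centred normal density by \<open>exp (c x)\<close> gives, up to a
  constant factor, the normal density with mean \<open>c s\<^sup>2\<close>. The factor is the moment generating function.\<close>
lemma has_bochner_integral_exp_normal:
  assumes "distributed M lborel X (normal_density 0 s)" "s > 0"
  shows "has_bochner_integral M (\<lambda>\<omega>. exp (c * X \<omega>)) (exp (c\<^sup>2 * s\<^sup>2 / 2))"
proof -
  have tilt: "normal_density 0 s x * exp (c * x) = exp (c\<^sup>2 * s\<^sup>2 / 2) * normal_density (c * s\<^sup>2) s x" for x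
  proof -
    have "- x\<^sup>2 / (2 * s\<^sup>2) + c * x = c\<^sup>2 * s\<^sup>2 / 2 - (x - c * s\<^sup>2)\<^sup>2 / (2 * s\<^sup>2)"
      using assms(2) by (simp add: field_simps power2_eq_square)
    hence "exp (- x\<^sup>2 / (2 * s\<^sup>2)) * exp (c * x) = exp (c\<^sup>2 * s\<^sup>2 / 2) * exp (- (x - c * s\<^sup>2)\<^sup>2 / (2 * s\<^sup>2))"
      by (simp add: exp_add[symmetric])
    thus ?thesis by (simp add: normal_density_def)
  qed
  have "integrable lborel (\<lambda>x. normal_density 0 s x * exp (c * x))"
    using assms(2) by (simp add: tilt)
  hence "integrable M (\<lambda>\<omega>. exp (c * X \<omega>))"
    by (subst (asm) distributed_integrable[OF assms(1)]) auto
  moreover have "(\<integral>\<omega>. exp (c * X \<omega>) \<partial>M) = exp (c\<^sup>2 * s\<^sup>2 / 2)"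
    using assms(2) by (subst distributed_integral[OF assms(1), symmetric]) (auto simp: tilt)
  ultimately show ?thesis by (simp add: has_bochner_integral_iff)
qed

context standard_brownian_motion
begin

lemma borel_measurable_brownian:
  assumes "0 \<le> t"
  shows "B t \<in> borel_measurable M"
proof (cases "t = 0")
  case True
  have "B 0 \<in> borel_measurable M \<longleftrightarrow> (\<lambda>_. 0 :: real) \<in> borel_measurable M"
    by (rule measurable_cong) (rule start_zero)
  with True show ?thesis by simp
next
  case False
  with assms have "distributed M lborel (\<lambda>\<omega>. B t \<omega> - B 0 \<omega>) (normal_density 0 (sqrt (t - 0)))"
    by (intro normal_increments) auto
  hence "(\<lambda>\<omega>. B t \<omega> - B 0 \<omega>) \<in> borel_measurable M"
    using distributed_measurable by fastforce
  moreover have "B t \<in> borel_measurable M \<longleftrightarrow> (\<lambda>\<omega>. B t \<omega> - B 0 \<omega>) \<in> borel_measurable M"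
    by (rule measurable_cong) (simp add: start_zero)
  ultimately show ?thesis by simp
qed

lemma exp_increment:
  assumes "0 \<le> s" "s \<le> t"
  shows "has_bochner_integral M (\<lambda>\<omega>. exp (c * (B t \<omega> - B s \<omega>))) (exp (c\<^sup>2 * (t - s) / 2))"
proof (cases "s = t")
  case True
  thus ?thesis by (simp add: has_bochner_integral_iff prob_space)
next
  case False
  with assms have "distributed M lborel (\<lambda>\<omega>. B t \<omega> - B s \<omega>) (normal_density 0 (sqrt (t - s)))"
    by (intro normal_increments) auto
  from has_bochner_integral_exp_normal[OF this, of c] False assms show ?thesis by simp
qed

lemma exp_brownian:
  assumes "0 \<le> t"
  shows "has_bochner_integral M (\<lambda>\<omega>. exp (c * B t \<omega>)) (exp (c\<^sup>2 * t / 2))"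
proof -
  have "has_bochner_integral M (\<lambda>\<omega>. exp (c * B t \<omega>)) (exp (c\<^sup>2 * t / 2)) \<longleftrightarrow>
      has_bochner_integral M (\<lambda>\<omega>. exp (c * (B t \<omega> - B 0 \<omega>))) (exp (c\<^sup>2 * t / 2))"
    by (rule has_bochner_integral_cong) (simp_all add: start_zero)
  thus ?thesis using exp_increment[OF order_refl assms, of c] by simp
qed

text \<open>Write \<open>B s + B t = 2 (B s - B 0) + (B t - B s)\<close> and use that the two increments are independent.
  The degenerate cases are separate since independence is assumed only for strictly increasing times.\<close>
lemma exp_brownian_mult:
  assumes "0 \<le> s" "s \<le> t"
  shows "has_bochner_integral M (\<lambda>\<omega>. exp (c * B s \<omega>) * exp (c * B t \<omega>)) (exp (c\<^sup>2 * (s + t) / 2 + c\<^sup>2 * s))"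
proof (cases "s = 0 \<or> s = t")
  case True
  thus ?thesis
  proof
    assume s: "s = 0"
    have "has_bochner_integral M (\<lambda>\<omega>. exp (c * B s \<omega>) * exp (c * B t \<omega>)) (exp (c\<^sup>2 * (s + t) / 2 + c\<^sup>2 * s)) \<longleftrightarrow>
      has_bochner_integral M (\<lambda>\<omega>. exp (c * B t \<omega>)) (exp (c\<^sup>2 * t / 2))"
      by (rule has_bochner_integral_cong) (simp_all add: start_zero s)
    thus ?thesis using exp_brownian assms by auto
  next
    assume "s = t"
    thus ?thesis using exp_brownian[of t "2 * c"] assms
      by (simp add: exp_add[symmetric] algebra_simps power2_eq_square)
  qed
next
  case False
  with assms have st: "0 < s" "s < t" by auto
  define u where "u = (\<lambda>i :: nat. if i = 0 then 0 else if i = 1 then s else t)"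
  define d where "d = (\<lambda>i :: nat. if i = 0 then 2 * c else c)"
  define Z where "Z = (\<lambda>i \<omega>. exp (d i * (B (u (Suc i)) \<omega> - B (u i) \<omega>)))"
  have "indep_vars (\<lambda>_. borel) (\<lambda>i \<omega>. B (u (Suc i)) \<omega> - B (u i) \<omega>) {..<2}"
    by (rule indep_increments) (use st in \<open>auto simp: u_def less_2_cases_iff\<close>)
  hence indep: "indep_vars (\<lambda>_. borel) Z {..<2}"
    unfolding Z_def by (rule indep_vars_compose2) auto
  have mean: "has_bochner_integral M (Z i) (exp ((d i)\<^sup>2 * (u (Suc i) - u i) / 2))" if "i \<in> {..<2}" for i
    unfolding Z_def using that st by (intro exp_increment) (auto simp: u_def less_2_cases_iff)
  hence int: "integrable M (Z i)" if "i \<in> {..<2}" for i using that by (auto simp: has_bochner_integral_iff)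
  have "has_bochner_integral M (\<lambda>\<omega>. \<Prod>i<2. Z i \<omega>) (\<Prod>i<2. exp ((d i)\<^sup>2 * (u (Suc i) - u i) / 2))"
    using indep_vars_lebesgue_integral[OF _ indep int] indep_vars_integrable[OF _ indep int] mean
    by (simp add: has_bochner_integral_iff)
  also have "(\<Prod>i<2. exp ((d i)\<^sup>2 * (u (Suc i) - u i) / 2)) = exp (c\<^sup>2 * (s + t) / 2 + c\<^sup>2 * s)"
    by (simp add: numeral_2_eq_2 u_def d_def exp_add[symmetric] power2_eq_square field_simps)
  also have "has_bochner_integral M (\<lambda>\<omega>. \<Prod>i<2. Z i \<omega>) (exp (c\<^sup>2 * (s + t) / 2 + c\<^sup>2 * s)) \<longleftrightarrow> ?thesis"
    by (rule has_bochner_integral_cong)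
       (simp_all add: Z_def numeral_2_eq_2 u_def d_def exp_add[symmetric] start_zero algebra_simps)
  finally show ?thesis .
qed

end

section \<open>Moments of geometric Brownian motion and of its time integral\<close>

context standard_brownian_motion
begin

text \<open>Geometric Brownian motion is \<open>exp ((r - \<sigma>\<^sup>2 / 2) * t + \<sigma> * B t)\<close>. Its drift correction \<open>- \<sigma>\<^sup>2 / 2\<close> cancels the
  Gaussian factor \<open>exp (\<sigma>\<^sup>2 * t / 2)\<close>.\<close>
lemma gbm_mean:
  assumes "0 \<le> t"
  shows "has_bochner_integral M (\<lambda>\<omega>. exp ((r - \<sigma>\<^sup>2 / 2) * t + \<sigma> * B t \<omega>)) (exp (r * t))"
  using has_bochner_integral_mult_right[OF exp_brownian[OF assms, of \<sigma>], of "exp ((r - \<sigma>\<^sup>2 / 2) * t)"]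
  by (simp add: exp_add[symmetric] algebra_simps)

lemma gbm_product_mean:
  assumes "0 \<le> s" "0 \<le> t"
  shows "has_bochner_integral M
    (\<lambda>\<omega>. exp ((r - \<sigma>\<^sup>2 / 2) * s + \<sigma> * B s \<omega>) * exp ((r - \<sigma>\<^sup>2 / 2) * t + \<sigma> * B t \<omega>))
    (exp (r * (s + t) + \<sigma>\<^sup>2 * min s t))"
  using assms
proof (induction s t rule: linorder_wlog)
  case (le s t)
  hence min: "min s t = s" by simp
  have "has_bochner_integral M
      (\<lambda>\<omega>. exp ((r - \<sigma>\<^sup>2 / 2) * (s + t)) * (exp (\<sigma> * B s \<omega>) * exp (\<sigma> * B t \<omega>)))
      (exp ((r - \<sigma>\<^sup>2 / 2) * (s + t)) * exp (\<sigma>\<^sup>2 * (s + t) / 2 + \<sigma>\<^sup>2 * s))"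
    using le by (intro has_bochner_integral_mult_right exp_brownian_mult)
  thus ?case
    by (simp add: min exp_add[symmetric] algebra_simps add_divide_distrib)
next
  case (sym s t)
  thus ?case by (simp add: mult.commute add.commute min.commute)
qed

text \<open>In the second moment of \<open>I\<close>, the integrand \<open>exp (r (s + t) + \<sigma>\<^sup>2 min s t)\<close> is symmetric, so the
  square \<open>[0, T]\<^sup>2\<close> contributes twice the triangle \<open>s \<le> t\<close>. On the triangle it is
  \<open>\<psi>' t * \<phi>' s\<close>, and the integral over \<open>s\<close> is \<open>\<psi>' t * \<phi> t = Q' t\<close>.\<close>
lemma gbm_time_integral_moments:
  fixes r \<sigma> T :: real and S :: "real \<Rightarrow> 'a \<Rightarrow> real" and \<phi> \<psi> Q :: "real \<Rightarrow> real"
  assumes T: "T > 0"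
    and S: "\<And>t \<omega>. t \<ge> 0 \<Longrightarrow> S t \<omega> = exp ((r - \<sigma>\<^sup>2 / 2) * t + \<sigma> * B t \<omega>)"
    and init: "\<phi> 0 = 0" "\<psi> 0 = 0" "Q 0 = 0"
    and \<phi>: "\<And>t. t \<in> {0..T} \<Longrightarrow> (\<phi> has_real_derivative exp ((r + \<sigma>\<^sup>2) * t)) (at t within {0..T})"
    and \<psi>: "\<And>t. t \<in> {0..T} \<Longrightarrow> (\<psi> has_real_derivative exp (r * t)) (at t within {0..T})"
    and Q: "\<And>t. t \<in> {0..T} \<Longrightarrow> (Q has_real_derivative exp (r * t) * \<phi> t) (at t within {0..T})"
  defines "I \<equiv> \<lambda>\<omega>. LBINT t:{0..T}. S t \<omega>"
  shows "has_bochner_integral M I (\<psi> T)"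
    and "has_bochner_integral M (\<lambda>\<omega>. S T \<omega> * I \<omega>) (exp (r * T) * \<phi> T)"
    and "has_bochner_integral M (\<lambda>\<omega>. I \<omega> * I \<omega>) (2 * Q T)"
proof -
  \<comment> \<open>Extending the process by its initial value to negative times makes it measurable and
    continuous on the whole line.\<close>
  define X where "X = (\<lambda>t \<omega>. exp ((r - \<sigma>\<^sup>2 / 2) * max 0 t + \<sigma> * B (max 0 t) \<omega>))"
  have X_S: "X t = S t" if "0 \<le> t" for t using that S by (auto simp: X_def)
  have I_X: "I = (\<lambda>\<omega>. LBINT t:{0..T}. X t \<omega>)"
    unfolding I_def using X_S by (intro ext set_lebesgue_integral_cong) auto
  have X_meas: "X t \<in> borel_measurable M" for t
    unfolding X_def using borel_measurable_brownian[of "max 0 t"] by measurable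
  have X_joint: "(\<lambda>(t, \<omega>). X t \<omega>) \<in> borel_measurable (borel \<Otimes>\<^sub>M M)"
  proof (rule borel_measurable_continuous_process[OF X_meas])
    fix \<omega> assume "\<omega> \<in> space M"
    from continuous_paths[OF this] have "continuous_on UNIV (\<lambda>t. B (max 0 t) \<omega>)"
      by (rule continuous_on_compose2[where g = "\<lambda>t. B t \<omega>"]) (auto intro!: continuous_intros)
    thus "continuous_on UNIV (\<lambda>t. X t \<omega>)" unfolding X_def by (intro continuous_intros)
  qed
  have X_pos: "0 \<le> X t \<omega>" for t \<omega> by (simp add: X_def)
  have I_pos: "0 \<le> I \<omega>" for \<omega>
    unfolding I_X set_lebesgue_integral_def by (intro integral_nonneg_AE) (auto simp: X_pos)
  have FTC: "(f has_integral F v - F u) {u..v}"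
    if "0 \<le> u" "u \<le> v" "v \<le> T" "\<And>t. t \<in> {0..T} \<Longrightarrow> (F has_real_derivative f t) (at t within {0..T})"
    for f F u v
  proof (rule fundamental_theorem_of_calculus[where f = F])
    show "(F has_vector_derivative f t) (at t within {u..v})" if "t \<in> {u..v}" for t
    proof -
      have "t \<in> {0..T}" "{u..v} \<subseteq> {0..T}"
        using that \<open>0 \<le> u\<close> \<open>v \<le> T\<close> by auto
      thus ?thesis
        using DERIV_subset[OF \<open>\<And>t. t \<in> {0..T} \<Longrightarrow> (F has_real_derivative f t) (at t within {0..T})\<close>]
        by (simp add: has_real_derivative_iff_has_vector_derivative)
    qed
  qed fact
  have cont: "continuous_on {0..T} \<phi>" "continuous_on {0..T} \<psi>"
    by (rule DERIV_continuous_on[OF \<phi>], simp, rule DERIV_continuous_on[OF \<psi>], simp)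
  have mean: "has_bochner_integral M (X t) (exp (r * t))" if "t \<in> {0..T}" for t
    using gbm_mean[of t r \<sigma>] that by (simp add: X_def)
  have product: "has_bochner_integral M (\<lambda>\<omega>. X s \<omega> * X t \<omega>) (exp (r * (s + t) + \<sigma>\<^sup>2 * min s t))"
    if "s \<in> {0..T}" "t \<in> {0..T}" for s t
    using gbm_product_mean[of s t r \<sigma>] that by (simp add: X_def)

  have "has_bochner_integral M (\<lambda>\<omega>. 1 * I \<omega>) (\<psi> T)"
    unfolding I_X
  proof (rule has_bochner_integral_time_integral[OF X_joint])
    show "((\<lambda>t. exp (r * t)) has_integral \<psi> T) {0..T}"
      using FTC[OF _ _ _ \<psi>, of 0 T] T init by simp
  qed (use mean in \<open>auto simp: X_pos intro!: continuous_intros\<close>)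
  thus first: "has_bochner_integral M I (\<psi> T)" by simp

  \<comment> \<open>For fixed \<open>s\<close> the minimum splits the time integral of \<open>E (S s * S t)\<close> at \<open>t = s\<close>.\<close>
  define g where "g = (\<lambda>s. exp (r * s) * (\<phi> s + exp (\<sigma>\<^sup>2 * s) * (\<psi> T - \<psi> s)))"
  have X_I: "has_bochner_integral M (\<lambda>\<omega>. X s \<omega> * I \<omega>) (g s)" if s: "s \<in> {0..T}" for s
    unfolding I_X
  proof (rule has_bochner_integral_time_integral[OF X_joint X_meas])
    let ?m = "\<lambda>t. exp (r * (s + t) + \<sigma>\<^sup>2 * min s t)"
    have "((\<lambda>t. exp (r * s) * exp ((r + \<sigma>\<^sup>2) * t)) has_integral exp (r * s) * (\<phi> s - \<phi> 0)) {0..s}"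
      using s by (intro has_integral_mult_right FTC[OF _ _ _ \<phi>]) auto
    moreover have "exp (r * s) * exp ((r + \<sigma>\<^sup>2) * t) = ?m t" if "t \<in> {0..s}" for t
      using that by (simp add: exp_add[symmetric] algebra_simps min_absorb2)
    ultimately have "(?m has_integral exp (r * s) * (\<phi> s - \<phi> 0)) {0..s}"
      by (rule has_integral_eq[rotated])
    moreover {
      have "((\<lambda>t. exp (r * s + \<sigma>\<^sup>2 * s) * exp (r * t)) has_integral exp (r * s + \<sigma>\<^sup>2 * s) * (\<psi> T - \<psi> s)) {s..T}"
        using s by (intro has_integral_mult_right FTC[OF _ _ _ \<psi>]) auto
      moreover have "exp (r * s + \<sigma>\<^sup>2 * s) * exp (r * t) = ?m t" if "t \<in> {s..T}" for t
        using that by (simp add: exp_add[symmetric] algebra_simps min_absorb1)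
      ultimately have "(?m has_integral exp (r * s + \<sigma>\<^sup>2 * s) * (\<psi> T - \<psi> s)) {s..T}"
        by (rule has_integral_eq[rotated]) }
    ultimately have "(?m has_integral
        exp (r * s) * (\<phi> s - \<phi> 0) + exp (r * s + \<sigma>\<^sup>2 * s) * (\<psi> T - \<psi> s)) {0..T}"
      using s by (intro has_integral_combine[of 0 s T]) auto
    thus "(?m has_integral g s) {0..T}" by (simp add: g_def init exp_add algebra_simps)
    show "continuous_on {0..T} ?m" by (intro continuous_intros)
  qed (use product s X_pos in auto)
  show "has_bochner_integral M (\<lambda>\<omega>. S T \<omega> * I \<omega>) (exp (r * T) * \<phi> T)"
    using X_I[of T] T X_S[of T] by (simp add: g_def)

  have "has_bochner_integral M (\<lambda>\<omega>. I \<omega> * (LBINT t:{0..T}. X t \<omega>)) (2 * Q T)"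
  proof (rule has_bochner_integral_time_integral[OF X_joint _ X_pos I_pos])
    show "I \<in> borel_measurable M" using first by (auto simp: has_bochner_integral_iff)
    show "has_bochner_integral M (\<lambda>\<omega>. I \<omega> * X t \<omega>) (g t)" if "t \<in> {0..T}" for t
      using X_I[OF that] by (simp add: mult.commute)
    show "continuous_on {0..T} g"
      unfolding g_def by (intro continuous_intros cont)
    \<comment> \<open>Integration by parts replaces the symmetry argument: this antiderivative of \<open>g\<close> is
      \<open>2 * Q\<close> at both ends of the interval.\<close>
    define P where "P = (\<lambda>t. 2 * Q t + \<psi> T * \<phi> t - \<psi> t * \<phi> t)"
    have "(P has_real_derivative g t) (at t within {0..T})" if "t \<in> {0..T}" for t
      unfolding P_def g_def
      by (rule derivative_eq_intros \<phi>[OF that] \<psi>[OF that] Q[OF that] refl)+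
         (simp add: exp_add algebra_simps)
    from FTC[OF _ _ _ this, of 0 T] T show "(g has_integral 2 * Q T) {0..T}"
      by (simp add: P_def init)
  qed
  thus "has_bochner_integral M (\<lambda>\<omega>. I \<omega> * I \<omega>) (2 * Q T)" by (simp add: I_X)
qed

end

section \<open>The correlation with the time average\<close>

lemma antiderivative_vanishing_at_left_end:
  fixes f :: "real \<Rightarrow> real"
  assumes "continuous_on {a..b} f"
  obtains F where "F a = 0" "\<And>t. t \<in> {a..b} \<Longrightarrow> (F has_real_derivative f t) (at t within {a..b})"
proof -
  from antiderivative_continuous[OF assms] obtain G where
    "\<And>t. t \<in> {a..b} \<Longrightarrow> (G has_vector_derivative f t) (at t within {a..b})" by blast
  hence "((\<lambda>t. G t - G a) has_real_derivative f t) (at t within {a..b})" if "t \<in> {a..b}" for t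
    using that by (auto intro!: derivative_eq_intros simp: has_real_derivative_iff_has_vector_derivative[symmetric])
  thus ?thesis using that[of "\<lambda>t. G t - G a"] by simp
qed

theorem theorem2p1:
  fixes M :: "'a measure" and B S :: "real \<Rightarrow> 'a \<Rightarrow> real" and A :: "'a \<Rightarrow> real"
    and r \<sigma> T :: real
  assumes "standard_brownian_motion M B"
    and "\<sigma> > 0" and "T > 0"
    and "\<And>t \<omega>. t \<ge> 0 \<Longrightarrow> S t \<omega> = exp ((r - \<sigma>\<^sup>2 / 2) * t + \<sigma> * B t \<omega>)"
    and "\<And>\<omega>. A \<omega> = 1 / T * (LBINT t:{0..T}. S t \<omega>)"
  shows "correlation M (S T) A =
    divided_difference exp [r * T, 2 * r * T, (2 * r + \<sigma>\<^sup>2) * T]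
    / sqrt (2 * divided_difference exp [2 * r * T, (2 * r + \<sigma>\<^sup>2) * T]
              * divided_difference exp [0, r * T, 2 * r * T, (2 * r + \<sigma>\<^sup>2) * T])"
proof -
  interpret standard_brownian_motion M B by fact
  note \<sigma> = \<open>\<sigma> > 0\<close> and T = \<open>T > 0\<close> and S = assms(4) and A = assms(5)
  obtain \<phi> where \<phi>: "\<phi> 0 = 0"
    "\<And>t. t \<in> {0..T} \<Longrightarrow> (\<phi> has_real_derivative exp ((r + \<sigma>\<^sup>2) * t)) (at t within {0..T})"
    by (rule antiderivative_vanishing_at_left_end[of 0 T "\<lambda>t. exp ((r + \<sigma>\<^sup>2) * t)"])
       (auto intro!: continuous_intros)
  obtain \<psi> where \<psi>: "\<psi> 0 = 0"
    "\<And>t. t \<in> {0..T} \<Longrightarrow> (\<psi> has_real_derivative exp (r * t)) (at t within {0..T})"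
    by (rule antiderivative_vanishing_at_left_end[of 0 T "\<lambda>t. exp (r * t)"])
       (auto intro!: continuous_intros)
  have "continuous_on {0..T} (\<lambda>t. exp (r * t) * \<phi> t)"
    using \<phi>(2) by (intro continuous_intros DERIV_continuous_on)
  then obtain Q where Q: "Q 0 = 0"
    "\<And>t. t \<in> {0..T} \<Longrightarrow> (Q has_real_derivative exp (r * t) * \<phi> t) (at t within {0..T})"
    using antiderivative_vanishing_at_left_end[of 0 T "\<lambda>t. exp (r * t) * \<phi> t"] by blast

  \<comment> \<open>Read backwards, the lists of points in the three divided differences are the initial segments, of
    lengths two, three and four, of the exponents \<open>l\<close> of this chain, multiplied by \<open>T\<close>.
    Each member solves its equation by variation of constants: \<open>F2\<close> because
    \<open>\<phi>' - \<psi>' = exp (r t) (exp (\<sigma>\<^sup>2 t) - 1)\<close>, and \<open>F3\<close> because \<open>Q' - \<psi> \<psi>' = exp (r t) (\<phi> - \<psi>)\<close>.\<close>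
  define F0 F1 F2 F3 :: "real \<Rightarrow> real"
    where "F0 = (\<lambda>t. exp ((2 * r + \<sigma>\<^sup>2) * t))"
      and "F1 = (\<lambda>t. exp (2 * r * t) * (exp (\<sigma>\<^sup>2 * t) - 1) / \<sigma>\<^sup>2)"
      and "F2 = (\<lambda>t. exp (r * t) * (\<phi> t - \<psi> t) / \<sigma>\<^sup>2)"
      and "F3 = (\<lambda>t. (Q t - (\<psi> t)\<^sup>2 / 2) / \<sigma>\<^sup>2)"
  note F_defs = F0_def F1_def F2_def F3_def
  define F where "F = (!) [F0, F1, F2, F3]"
  define l where "l = (!) [2 * r + \<sigma>\<^sup>2, 2 * r, r, 0]"
  have F0: "(F0 has_real_derivative (2 * r + \<sigma>\<^sup>2) * F0 t) (at t within {0..T})" for t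
    unfolding F_defs by (auto intro!: derivative_eq_intros)
  have F1: "(F1 has_real_derivative 2 * r * F1 t + F0 t) (at t within {0..T})" for t
    unfolding F_defs using \<sigma>
    by (auto intro!: derivative_eq_intros simp: divide_simps) (simp add: algebra_simps exp_add)
  have F2: "(F2 has_real_derivative r * F2 t + F1 t) (at t within {0..T})" if "t \<in> {0..T}" for t
    unfolding F_defs using \<sigma>
    by (auto intro!: derivative_eq_intros \<phi>(2)[OF that] \<psi>(2)[OF that]
        simp: field_simps exp_add[symmetric])
  have F3: "(F3 has_real_derivative F2 t) (at t within {0..T})" if "t \<in> {0..T}" for t
    unfolding F_defs using \<sigma>
    by (auto intro!: derivative_eq_intros \<psi>(2)[OF that] Q(2)[OF that] simp: field_simps)
  have dd: "divided_difference exp (map (\<lambda>k. l k * T) [0..<Suc n]) = F n T / T ^ n" if "n \<le> 3" for n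
  proof (rule divided_difference_exp_eq_cascade_at[OF T])
    fix k assume "k \<le> n"
    with that have k: "k \<in> {0, 1, 2, 3}" by auto
    thus "F k 0 = (if k = 0 then 1 else 0)"
      by (auto simp: F_def F_defs \<phi>(1) \<psi>(1) Q(1))
    show "(F k has_real_derivative l k * F k t + (if k = 0 then 0 else F (k - 1) t)) (at t within {0..T})"
      if "t \<in> {0..T}" for t
      using k F0 F1 F2[OF that] F3[OF that] by (auto simp: F_def l_def)
  qed
  have dd_var_S: "divided_difference exp [2 * r * T, (2 * r + \<sigma>\<^sup>2) * T] = F1 T / T"
    using dd[of 1] divided_difference_rev[of exp "[(2 * r + \<sigma>\<^sup>2) * T, 2 * r * T]"]
    by (simp add: F_def l_def)
  have dd_cov: "divided_difference exp [r * T, 2 * r * T, (2 * r + \<sigma>\<^sup>2) * T] = F2 T / T ^ 2"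
    using dd[of 2] divided_difference_rev[of exp "[(2 * r + \<sigma>\<^sup>2) * T, 2 * r * T, r * T]"]
    by (simp add: F_def l_def numeral_2_eq_2)
  have dd_var_A: "divided_difference exp [0, r * T, 2 * r * T, (2 * r + \<sigma>\<^sup>2) * T] = F3 T / T ^ 3"
    using dd[of 3] divided_difference_rev[of exp "[(2 * r + \<sigma>\<^sup>2) * T, 2 * r * T, r * T, 0]"]
    by (simp add: F_def l_def numeral_3_eq_3)

  have A: "A = (\<lambda>\<omega>. (LBINT t:{0..T}. S t \<omega>) / T)" using A by auto
  note moments = gbm_time_integral_moments[OF T S \<phi>(1) \<psi>(1) Q(1) \<phi>(2) \<psi>(2) Q(2)]
  have mean_A: "has_bochner_integral M A (\<psi> T / T)"
    unfolding A by (intro has_bochner_integral_divide_zero moments(1))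
  have mean_SA: "has_bochner_integral M (\<lambda>\<omega>. S T \<omega> * A \<omega>) (exp (r * T) * \<phi> T / T)"
    unfolding A using has_bochner_integral_divide_zero[OF moments(2), of T] by simp
  have mean_AA: "has_bochner_integral M (\<lambda>\<omega>. (A \<omega>)\<^sup>2) (2 * Q T / T\<^sup>2)"
    unfolding A using has_bochner_integral_divide_zero[OF moments(3), of "T\<^sup>2"]
    by (simp add: power2_eq_square)
  have S_T: "S T = (\<lambda>\<omega>. exp ((r - \<sigma>\<^sup>2 / 2) * T + \<sigma> * B T \<omega>))" using S T by auto
  have mean_S: "has_bochner_integral M (S T) (exp (r * T))"
    unfolding S_T using T by (intro gbm_mean) simp
  have mean_SS: "has_bochner_integral M (\<lambda>\<omega>. (S T \<omega>)\<^sup>2) (exp (2 * r * T + \<sigma>\<^sup>2 * T))"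
    unfolding S_T using gbm_product_mean[of T T r \<sigma>] T by (simp add: power2_eq_square algebra_simps)

  have "variance (S T) = exp (2 * r * T + \<sigma>\<^sup>2 * T) - (exp (r * T))\<^sup>2"
    using mean_S mean_SS by (subst variance_eq) (auto simp: has_bochner_integral_iff)
  also have "\<dots> = exp (2 * r * T) * (exp (\<sigma>\<^sup>2 * T) - 1)"
    by (simp add: exp_add exp_double[symmetric] algebra_simps)
  also have "\<dots> = \<sigma>\<^sup>2 * F1 T"
    using \<sigma> by (simp add: F1_def)
  finally have var_S: "variance (S T) = \<sigma>\<^sup>2 * F1 T" .
  have "variance A = 2 * Q T / T\<^sup>2 - (\<psi> T / T)\<^sup>2"
    using mean_A mean_AA by (subst variance_eq) (auto simp: has_bochner_integral_iff)
  also have "\<dots> = 2 * \<sigma>\<^sup>2 * F3 T / T\<^sup>2"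
    using \<sigma> T by (simp add: F3_def field_simps)
  finally have var_A: "variance A = 2 * \<sigma>\<^sup>2 * F3 T / T\<^sup>2" .
  have "expectation (\<lambda>\<omega>. S T \<omega> * A \<omega>) - expectation (S T) * expectation A =
      exp (r * T) * \<phi> T / T - exp (r * T) * (\<psi> T / T)"
    using mean_SA mean_S mean_A by (simp add: has_bochner_integral_iff)
  also have "\<dots> = \<sigma>\<^sup>2 * F2 T / T"
    using \<sigma> T by (simp add: F2_def field_simps)
  finally have cov: "expectation (\<lambda>\<omega>. S T \<omega> * A \<omega>) - expectation (S T) * expectation A = \<sigma>\<^sup>2 * F2 T / T" .

  \<comment> \<open>Pulling the positive factor \<open>(\<sigma>\<^sup>2 * T)\<^sup>2\<close> out of the root leaves the root in the claim.\<close>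
  define R where "R = sqrt (2 * (F1 T / T) * (F3 T / T ^ 3))"
  have "\<sigma>\<^sup>2 * F1 T * (2 * \<sigma>\<^sup>2 * F3 T / T\<^sup>2) = (\<sigma>\<^sup>2 * T)\<^sup>2 * (2 * (F1 T / T) * (F3 T / T ^ 3))"
    using T by (simp add: field_simps power2_eq_square power3_eq_cube)
  hence "sqrt (\<sigma>\<^sup>2 * F1 T * (2 * \<sigma>\<^sup>2 * F3 T / T\<^sup>2)) = sqrt ((\<sigma>\<^sup>2 * T)\<^sup>2) * R"
    unfolding R_def by (metis real_sqrt_mult)
  also have "sqrt ((\<sigma>\<^sup>2 * T)\<^sup>2) = \<sigma>\<^sup>2 * T"
    using T by simp
  finally have "sqrt (\<sigma>\<^sup>2 * F1 T * (2 * \<sigma>\<^sup>2 * F3 T / T\<^sup>2)) = \<sigma>\<^sup>2 * T * R" .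
  hence "correlation M (S T) A = (\<sigma>\<^sup>2 * F2 T / T) / (\<sigma>\<^sup>2 * T * R)"
    unfolding correlation_def cov var_S var_A by simp
  also have "\<dots> = (F2 T / T\<^sup>2) / R"
    using \<sigma> T by (simp add: power2_eq_square)
  finally show ?thesis unfolding dd_var_S dd_cov dd_var_A R_def .
qed

end
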